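(* Let $p>0$. The vector space $\mathbb{P}_p$ of all $p$-periodic functions $\mathbb{R}\to\mathbb{R}$ is the direct sum of its subspaces $\mathbb{P}_{p/2}$, the space of all $p/2$-periodic functions, and $\mathbb{AP}_{p/2}$, the space of all $p/2$-antiperiodic functions: $\mathbb{P}_p=\mathbb{P}_{p/2}\oplus\mathbb{AP}_{p/2}$.
   Context: $\mathcal{F}$ is the real vector space of all functions $f:\mathbb{R}\to\mathbb{R}$. For $q>0$, $\mathbb{P}_q=\{f\in\mathcal{F}: f(x+q)=f(x)\text{ for all }x\in\mathbb{R}\}$ is the space of $q$-periodic functions ($q$ need not be the minimal period), and $\mathbb{AP}_q=\{f\in\mathcal{F}: f(x+q)=-f(x)\text{ for all }x\in\mathbb{R}\}$ is the space of $q$-antiperiodic functions. *)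

theory Defs
  imports Complex_Main "HOL-Library.Function_Algebras" "HOL-Library.Set_Algebras"
begin

text \<open>The pointwise real vector space structure on functions; addition and zero are those of
  \<^theory>\<open>HOL-Library.Function_Algebras\<close>.\<close>

instantiation "fun" :: (type, real_vector) real_vector
begin

definition scaleR_fun :: "real \<Rightarrow> ('a \<Rightarrow> 'b) \<Rightarrow> 'a \<Rightarrow> 'b"
  where "scaleR_fun c f = (\<lambda>x. c *\<^sub>R f x)"

instance
  by standard (simp_all add: scaleR_fun_def fun_eq_iff scaleR_add_right scaleR_add_left)

end

definition periodic_funs :: "real \<Rightarrow> (real \<Rightarrow> real) set"
  where "periodic_funs q = {f. \<forall>x. f (x + q) = f x}"

definition antiperiodic_funs :: "real \<Rightarrow> (real \<Rightarrow> real) set"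
  where "antiperiodic_funs q = {f. \<forall>x. f (x + q) = - f x}"

text \<open>The internal direct sum of two subspaces; \<open>U + W\<close> is the elementwise sum of sets from
  \<^theory>\<open>HOL-Library.Set_Algebras\<close>.\<close>

definition is_direct_sum :: "'a::real_vector set \<Rightarrow> 'a set \<Rightarrow> 'a set \<Rightarrow> bool"
  where "is_direct_sum V U W \<longleftrightarrow>
    subspace V \<and> subspace U \<and> subspace W \<and> U \<subseteq> V \<and> W \<subseteq> V \<and> V = U + W \<and> U \<inter> W = {0}"

lemma is_direct_sum_unique_decomposition:
  assumes "is_direct_sum V U W" and "v \<in> V"
  shows "\<exists>!(u, w). u \<in> U \<and> w \<in> W \<and> v = u + w"
proof -
  have U: "subspace U" and W: "subspace W" and V: "V = U + W" and 0: "U \<inter> W = {0}"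
    using assms(1) by (auto simp: is_direct_sum_def)
  from \<open>v \<in> V\<close> obtain u w where uw: "u \<in> U" "w \<in> W" "v = u + w"
    unfolding V by (rule set_plus_elim)
  show ?thesis
  proof (rule ex1I[of _ "(u, w)"])
    show "case (u, w) of (u, w) \<Rightarrow> u \<in> U \<and> w \<in> W \<and> v = u + w"
      using uw by simp
  next
    fix z assume z: "case z of (u, w) \<Rightarrow> u \<in> U \<and> w \<in> W \<and> v = u + w"
    obtain u' w' where [simp]: "z = (u', w')" by (cases z)
    have z': "u' \<in> U" "w' \<in> W" "v = u' + w'" using z by auto
    have eq: "u - u' = w' - w" using uw(3) z'(3) by (simp add: algebra_simps)
    have "u - u' \<in> U" using U uw(1) z'(1) by (rule subspace_diff)
    moreover have "u - u' \<in> W" unfolding eq using W z'(2) uw(2) by (rule subspace_diff)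
    ultimately have "u - u' = 0" using 0 by blast
    with eq show "z = (u, w)" by simp
  qed
qed

end

theory Submission
  imports Defs
begin

text \<open>Translation by half a period, \<open>T f = (\<lambda>x. f (x + p / 2))\<close>, is a linear operator on functions,
  and \<open>f\<close> is \<open>p\<close>-periodic exactly when \<open>T (T f) = f\<close>. On the \<open>p\<close>-periodic functions \<open>T\<close> is therefore
  an involution, and such an operator splits its space into the eigenspaces for \<open>1\<close> and \<open>-1\<close>, which
  here are the \<open>p/2\<close>-periodic and the \<open>p/2\<close>-antiperiodic functions. The splitting is
  \<open>f = (f + T f) / 2 + (f - T f) / 2\<close>, as for the even and odd parts of a function
  (\<open>periodic_splits_half_period\<close>). The eigenspaces meet only in zero because \<open>T f = f\<close> and
  \<open>T f = - f\<close> force \<open>f = - f\<close>.\<close>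

lemma subspace_periodic_funs: "subspace (periodic_funs q)"
  by (simp add: subspace_def periodic_funs_def scaleR_fun_def)

lemma subspace_antiperiodic_funs: "subspace (antiperiodic_funs q)"
  by (simp add: subspace_def antiperiodic_funs_def scaleR_fun_def)

lemma periodic_double: "f \<in> periodic_funs q \<Longrightarrow> f (x + 2 * q) = f x"
  unfolding periodic_funs_def mult_2 add.assoc[symmetric] by (simp only: mem_Collect_eq)

lemma antiperiodic_double: "f \<in> antiperiodic_funs q \<Longrightarrow> f (x + 2 * q) = f x"
  unfolding antiperiodic_funs_def mult_2 add.assoc[symmetric] by (simp only: mem_Collect_eq minus_minus)

lemma periodic_Int_antiperiodic: "periodic_funs q \<inter> antiperiodic_funs q = {0}"
proof
  show "periodic_funs q \<inter> antiperiodic_funs q \<subseteq> {0}"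
  proof
    fix f assume f: "f \<in> periodic_funs q \<inter> antiperiodic_funs q"
    have "f x = - f x" for x
    proof -
      have "f (x + q) = f x" "f (x + q) = - f x"
        using f unfolding periodic_funs_def antiperiodic_funs_def by blast+
      then show ?thesis by (rule subst)
    qed
    then show "f \<in> {0}"
      by (simp add: fun_eq_iff)
  qed
  show "{0} \<subseteq> periodic_funs q \<inter> antiperiodic_funs q"
    using subspace_0[OF subspace_periodic_funs] subspace_0[OF subspace_antiperiodic_funs] by simp
qed

text \<open>The two summands are the images of \<open>f\<close> under the projections \<open>(1 + T) / 2\<close> and \<open>(1 - T) / 2\<close>
  onto the eigenspaces of the translation \<open>T\<close> by \<open>q\<close>: since \<open>T\<close> exchanges \<open>f\<close> and \<open>T f\<close>, it fixes
  the first summand and negates the second.\<close>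

lemma periodic_splits_half_period:
  assumes "f \<in> periodic_funs (2 * q)"
  shows "f \<in> periodic_funs q + antiperiodic_funs q"
proof -
  define u where "u = (\<lambda>x. (f x + f (x + q)) / 2)"
  define w where "w = (\<lambda>x. (f x - f (x + q)) / 2)"
  have T2: "f (x + 2 * q) = f x" for x
    using assms by (simp add: periodic_funs_def)
  have "u \<in> periodic_funs q"
    by (simp add: periodic_funs_def u_def T2 add.commute[of "2 * q"])
  moreover have "w \<in> antiperiodic_funs q"
    by (simp add: antiperiodic_funs_def w_def T2 add.commute[of "2 * q"] minus_divide_left)
  moreover have "f = u + w"
    by (simp add: fun_eq_iff u_def w_def field_simps)
  ultimately show ?thesis
    by (metis set_plus_intro)
qed

theorem theorem2p1:
  fixes p :: real
  assumes "p > 0"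
  shows "is_direct_sum (periodic_funs p) (periodic_funs (p / 2)) (antiperiodic_funs (p / 2))"
proof -
  let ?P = "periodic_funs p" and ?U = "periodic_funs (p / 2)" and ?W = "antiperiodic_funs (p / 2)"
  have U: "?U \<subseteq> ?P"
    using periodic_double[of _ "p / 2"] by (auto simp: periodic_funs_def[of p])
  have W: "?W \<subseteq> ?P"
    using antiperiodic_double[of _ "p / 2"] by (auto simp: periodic_funs_def[of p])
  have "?P \<subseteq> ?U + ?W"
    using periodic_splits_half_period[of _ "p / 2"] by auto
  moreover have "?U + ?W \<subseteq> ?P"
    using U W subspace_add[OF subspace_periodic_funs] by (blast elim: set_plus_elim)
  ultimately show ?thesis
    unfolding is_direct_sum_def
    using U W subspace_periodic_funs subspace_antiperiodic_funs periodic_Int_antiperiodic by blast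
qed

end
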